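(* Set $\hbar=1$. For $\nu_0>1/2$, the radial Bures length, at fixed $(r,\varphi)$, from $\nu_0$ to the boundary $\nu=1/2$ of the one-mode covariance family $\Sigma(\nu,r,\varphi)=\nu G(r,\varphi)$ is finite: $$\ell(\nu_0,\tfrac12)=\int_{1/2}^{\nu_0}\sqrt{g^{\rm B}_{\nu\nu}}\,d\nu=\frac12\operatorname{arccosh}(2\nu_0).$$
   Context: $G(r,\varphi)=R(\varphi)\operatorname{diag}(e^{2r},e^{-2r})R(\varphi)^{\mathsf T}$ with $R(\varphi)$ the $2\times2$ rotation by angle $\varphi$. The Bures metric is $g^{\rm B}_{ij}=\frac14F_{ij}$, with $F_{ij}=\frac12\operatorname{Tr}(\mathfrak G_i\partial_j\Sigma)$ and $\mathfrak G_i$ the real symmetric solution of $\Sigma\mathfrak G_i\Sigma+\frac14\Omega\mathfrak G_i\Omega=\partial_i\Sigma$, $\Omega=\begin{pmatrix}0&1\\-1&0\end{pmatrix}$. Its radial coefficient is $g^{\rm B}_{\nu\nu}=\dfrac{1}{4(\nu^2-\frac14)}$ for $\nu>1/2$. *)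

theory Defs
  imports "HOL-Analysis.Analysis"
begin

definition Omega :: "real^2^2" where
  "Omega = vector [vector [0, 1], vector [- 1, 0]]"

definition rot :: "real \<Rightarrow> real^2^2" where
  "rot \<phi> = vector [vector [cos \<phi>, - sin \<phi>], vector [sin \<phi>, cos \<phi>]]"

definition squeeze :: "real \<Rightarrow> real \<Rightarrow> real^2^2" where
  "squeeze r \<phi> =
     rot \<phi> ** vector [vector [exp (2 * r), 0], vector [0, exp (- 2 * r)]] ** transpose (rot \<phi>)"

text \<open>The parameter vector is \<open>\<theta> = (\<nu>, r, \<phi>)\<close>.\<close>

definition cov :: "real^3 \<Rightarrow> real^2^2" where
  "cov \<theta> = (\<theta> $ 1) *\<^sub>R squeeze (\<theta> $ 2) (\<theta> $ 3)"

definition partial_deriv ::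
    "'n \<Rightarrow> (real^'n \<Rightarrow> 'b::real_normed_vector) \<Rightarrow> real^'n \<Rightarrow> 'b" where
  "partial_deriv i f \<theta> = vector_derivative (\<lambda>t. f (\<theta> + t *\<^sub>R axis i 1)) (at 0)"

text \<open>The coefficient \<open>1/4\<close> is \<open>\<hbar>\<^sup>2/4\<close> with \<open>\<hbar> = 1\<close>.  The description operator below is
  meaningful where the equation has exactly one symmetric solution; for \<^const>\<open>cov\<close> this is the
  case when \<open>\<nu> > 1/2\<close>, but not at the boundary \<open>\<nu> = 1/2\<close>.\<close>

definition sld_matrix :: "(real^'n \<Rightarrow> real^2^2) \<Rightarrow> 'n \<Rightarrow> real^'n \<Rightarrow> real^2^2" where
  "sld_matrix S i \<theta> =
     (THE X. transpose X = X \<and>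
             S \<theta> ** X ** S \<theta> + (1/4) *\<^sub>R (Omega ** X ** Omega) = partial_deriv i S \<theta>)"

definition fisher :: "(real^'n \<Rightarrow> real^2^2) \<Rightarrow> 'n \<Rightarrow> 'n \<Rightarrow> real^'n \<Rightarrow> real" where
  "fisher S i j \<theta> = 1/2 * trace (sld_matrix S i \<theta> ** partial_deriv j S \<theta>)"

definition bures_metric :: "(real^'n \<Rightarrow> real^2^2) \<Rightarrow> 'n \<Rightarrow> 'n \<Rightarrow> real^'n \<Rightarrow> real" where
  "bures_metric S i j \<theta> = 1/4 * fisher S i j \<theta>"

text \<open>The length takes values in the extended nonnegative reals, so that its finiteness is a
  genuine assertion.  The endpoints of the curve, where the metric may be singular, are left out
  of the domain of integration.\<close>

definition bures_length ::
    "(real^'n \<Rightarrow> real^2^2) \<Rightarrow> (real \<Rightarrow> real^'n) \<Rightarrow> real \<Rightarrow> real \<Rightarrow> ennreal" where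
  "bures_length S \<gamma> a b =
     (\<integral>\<^sup>+t\<in>{a<..<b}. ennreal (sqrt (\<Sum>i\<in>UNIV. \<Sum>j\<in>UNIV.
        bures_metric S i j (\<gamma> t) * vector_derivative \<gamma> (at t) $ i * vector_derivative \<gamma> (at t) $ j))
      \<partial>lborel)"

definition radial_curve :: "real \<Rightarrow> real \<Rightarrow> real \<Rightarrow> real^3" where
  "radial_curve r \<phi> \<nu> = vector [\<nu>, r, \<phi>]"

end

theory Submission
  imports Defs
begin

text \<open>The squeezing matrix \<open>G\<close> is symmetric and symplectic, that is, \<open>G \<Omega> G = \<Omega>\<close>, so that
  \<open>\<Omega> G \<Omega> = - G\<^sup>-\<^sup>1\<close>.  Hence \<open>X = c G\<^sup>-\<^sup>1\<close> turns the equation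
  \<open>\<nu>\<^sup>2 G X G + 1/4 \<Omega> X \<Omega> = G\<close> into \<open>c (\<nu>\<^sup>2 - 1/4) = 1\<close>, and the metric coefficient is \<open>c/4\<close>.
  A solution \<open>Y\<close> of the homogeneous equation satisfies \<open>G Y G = k \<Omega> Y \<Omega>\<close> with \<open>k = - 1/(4 \<nu>\<^sup>2)\<close>;
  conjugating once more yields \<open>\<Omega> Y \<Omega> = k\<^sup>2 \<Omega> Y \<Omega>\<close> and thus \<open>Y = 0\<close>.  The length is then the
  integral of \<open>1 / sqrt (4 \<nu>\<^sup>2 - 1)\<close>, whose antiderivative \<open>1/2 arcosh (2 \<nu>)\<close> is continuous up to
  the singular endpoint, where it vanishes.\<close>

lemma matrix_minus_mult: "(- A) ** B = - (A ** B)" "A ** (- B) = - (A ** B)"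
  for A :: "real^'n^'m" and B :: "real^'k^'n"
  by (simp_all add: matrix_matrix_mult_def vec_eq_iff sum_negf)

lemma matrix_diff_mult: "(A - B) ** C = A ** C - B ** C" "C' ** (A - B) = C' ** A - C' ** B"
  for A B :: "real^'n^'m" and C :: "real^'k^'n"
  by (simp_all add: matrix_matrix_mult_def vec_eq_iff sum_subtractf algebra_simps)

lemma transpose_minus: "transpose (- A) = - transpose A" for A :: "real^'n^'m"
  by (simp add: transpose_def vec_eq_iff)

lemma trace_minus: "trace (- A) = - trace A" for A :: "real^'n^'n"
  by (simp add: trace_def sum_negf)

lemma trace_scaleR: "trace (c *\<^sub>R A) = c * trace A" for A :: "real^'n^'n"
  by (simp add: trace_def sum_distrib_left)

lemma Omega_Omega: "Omega ** Omega = - mat 1"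
  by (simp add: Omega_def matrix_matrix_mult_def vec_eq_iff forall_2 sum_2 mat_def)

lemma transpose_Omega: "transpose Omega = - Omega"
  by (simp add: Omega_def transpose_def vec_eq_iff forall_2)

text \<open>\<open>Omega\<close> is itself the rotation by -\<pi>/2, and plane rotations
  commute.\<close>

lemma rot_Omega:
  "transpose (rot \<phi>) ** Omega ** rot \<phi> = Omega"
  "rot \<phi> ** Omega ** transpose (rot \<phi>) = Omega"
  by (simp_all add: Omega_def rot_def transpose_def matrix_matrix_mult_def vec_eq_iff forall_2 sum_2
      algebra_simps flip: power2_eq_square)

text \<open>Instance of \<open>M ** Omega ** transpose M = det M *\<^sub>R Omega\<close>, valid for
  every 2x2 matrix; here \<open>M\<close> is diagonal with determinant 1.\<close>

lemma diag_Omega: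
  fixes a b :: real
  assumes "a * b = 1"
  defines "D \<equiv> vector [vector [a, 0], vector [0, b]] :: real^2^2"
  shows "D ** Omega ** D = Omega"
  using assms(1)
  by (simp add: D_def Omega_def matrix_matrix_mult_def vec_eq_iff forall_2 sum_2
      mult.commute)

lemma squeeze_Omega: "squeeze r \<phi> ** Omega ** squeeze r \<phi> = Omega"
proof -
  define D :: "real^2^2" where "D = vector [vector [exp (2 * r), 0], vector [0, exp (- 2 * r)]]"
  have D: "D ** Omega ** D = Omega"
    unfolding D_def by (rule diag_Omega) (simp flip: exp_add)
  \<comment> \<open>Regrouped so that the rotations, the diagonal factors and the rotations again
    act on \<open>Omega\<close> from the inside out, each pair fixing it.\<close>
  have "squeeze r \<phi> ** Omega ** squeeze r \<phi>
      = rot \<phi> ** (D ** (transpose (rot \<phi>) ** Omega ** rot \<phi>) ** D) ** transpose (rot \<phi>)"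
    by (simp add: squeeze_def D_def matrix_mul_assoc)
  then show ?thesis
    by (simp add: D rot_Omega)
qed

lemma transpose_squeeze: "transpose (squeeze r \<phi>) = squeeze r \<phi>"
proof -
  have "transpose D = D" if "D = vector [vector [a, 0], vector [0, b]]" for D :: "real^2^2" and a b
    using that by (simp add: transpose_def vec_eq_iff forall_2)
  then show ?thesis
    by (simp add: squeeze_def matrix_transpose_mul matrix_mul_assoc)
qed

text \<open>The two signs from \<open>Omega ** Omega = - mat 1\<close> cancel, so conjugation by
  \<open>Omega\<close> in this sense is an involution, hence injective.\<close>

lemma Omega_sandwich_twice: "Omega ** (Omega ** Y ** Omega) ** Omega = Y"
proof -
  have "Omega ** (Omega ** Y ** Omega) ** Omega = (Omega ** Omega) ** Y ** (Omega ** Omega)"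
    by (simp add: matrix_mul_assoc)
  then show ?thesis
    by (simp add: Omega_Omega matrix_minus_mult)
qed

lemma sld_equation_kernel:
  assumes G: "G ** Omega ** G = Omega" and k: "k\<^sup>2 \<noteq> 1"
    and Y: "G ** Y ** G = k *\<^sub>R (Omega ** Y ** Omega)"
  shows "Y = 0"
proof -
  \<comment> \<open>Trading each \<open>Omega\<close> for \<open>G ** Omega ** G\<close> exposes an
    inner \<open>G ** Y ** G\<close>. The hypothesis then applies twice, each time giving a factor
    \<open>k\<close>.\<close>
  have "Omega ** Y ** Omega = (G ** Omega ** G) ** Y ** (G ** Omega ** G)"
    by (simp add: G)
  also have "\<dots> = G ** Omega ** (G ** Y ** G) ** Omega ** G"
    by (simp add: matrix_mul_assoc)
  also have "\<dots> = G ** (k *\<^sub>R (Omega ** (Omega ** Y ** Omega) ** Omega)) ** G"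
    by (simp add: Y matrix_mul_assoc matrix_scalar_ac flip: scalar_matrix_assoc)
  also have "\<dots> = k *\<^sub>R (G ** Y ** G)"
    by (simp add: Omega_sandwich_twice matrix_scalar_ac flip: scalar_matrix_assoc)
  also have "\<dots> = k\<^sup>2 *\<^sub>R (Omega ** Y ** Omega)"
    by (simp add: Y power2_eq_square)
  finally have "(1 - k\<^sup>2) *\<^sub>R (Omega ** Y ** Omega) = 0"
    by (simp add: scaleR_left_diff_distrib)
  with k have "Omega ** Y ** Omega = 0"
    by simp
  then show ?thesis
    using Omega_sandwich_twice[of Y] by simp
qed

text \<open>From \<open>G ** Omega ** G = Omega\<close> it follows that
  \<open>- (Omega ** G ** Omega)\<close> is the inverse of \<open>G\<close>, so \<open>X\<close> is
  \<open>c\<close> times that inverse, written without inversion.\<close>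

lemma sld_equation_solution:
  assumes G: "G ** Omega ** G = Omega" and c: "c * (\<nu>\<^sup>2 - 1/4) = 1"
  defines "X \<equiv> (- c) *\<^sub>R (Omega ** G ** Omega)"
  shows "(\<nu> *\<^sub>R G) ** X ** (\<nu> *\<^sub>R G) + (1/4) *\<^sub>R (Omega ** X ** Omega) = G"
proof -
  have "G ** (Omega ** G ** Omega) ** G = (G ** Omega ** G) ** Omega ** G"
    by (simp add: matrix_mul_assoc)
  also have "\<dots> = - G"
    by (simp add: G Omega_Omega matrix_minus_mult)
  finally have "G ** X ** G = c *\<^sub>R G"
    by (simp add: X_def matrix_minus_mult matrix_scalar_ac flip: scalar_matrix_assoc)
  then have "(\<nu> *\<^sub>R G) ** X ** (\<nu> *\<^sub>R G) = (\<nu>\<^sup>2 * c) *\<^sub>R G"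
    by (simp add: matrix_scalar_ac power2_eq_square flip: scalar_matrix_assoc)
  moreover have "Omega ** X ** Omega = (- c) *\<^sub>R G"
    by (simp add: X_def Omega_sandwich_twice matrix_minus_mult matrix_scalar_ac flip: scalar_matrix_assoc)
  ultimately have "(\<nu> *\<^sub>R G) ** X ** (\<nu> *\<^sub>R G) + (1/4) *\<^sub>R (Omega ** X ** Omega)
      = (c * (\<nu>\<^sup>2 - 1/4)) *\<^sub>R G"
    by (simp add: algebra_simps flip: scaleR_left_diff_distrib)
  then show ?thesis
    by (simp add: c)
qed

lemma partial_deriv_cov_1: "partial_deriv 1 cov \<theta> = squeeze (\<theta> $ 2) (\<theta> $ 3)"
proof -
  have "((\<lambda>t. (\<theta> $ 1 + t) *\<^sub>R squeeze (\<theta> $ 2) (\<theta> $ 3)) has_vector_derivative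
      squeeze (\<theta> $ 2) (\<theta> $ 3)) (at 0)"
    by (auto intro!: derivative_eq_intros simp: has_vector_derivative_def)
  then show ?thesis
    by (simp add: partial_deriv_def cov_def axis_def vector_derivative_at)
qed

lemma sld_matrix_cov_1:
  fixes \<theta> :: "real^3"
  assumes "\<theta> $ 1 > 1/2"
  shows "sld_matrix cov 1 \<theta> =
    (- (1 / ((\<theta> $ 1)\<^sup>2 - 1/4))) *\<^sub>R (Omega ** squeeze (\<theta> $ 2) (\<theta> $ 3) ** Omega)"
proof -
  define \<nu> where "\<nu> = \<theta> $ 1"
  define G where "G = squeeze (\<theta> $ 2) (\<theta> $ 3)"
  define Z where "Z = (- (1 / (\<nu>\<^sup>2 - 1/4))) *\<^sub>R (Omega ** G ** Omega)"
  have G: "G ** Omega ** G = Omega" and Gt: "transpose G = G"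
    by (simp_all add: G_def squeeze_Omega transpose_squeeze)
  have cov: "cov \<theta> = \<nu> *\<^sub>R G" and deriv: "partial_deriv 1 cov \<theta> = G"
    by (simp_all add: cov_def \<nu>_def G_def partial_deriv_cov_1)
  have "(1/2)\<^sup>2 < \<nu>\<^sup>2"
    using assms unfolding \<nu>_def by (intro power_strict_mono) auto
  then have \<nu>: "\<nu>\<^sup>2 > 1/4"
    by (simp add: power2_eq_square)
  have Z: "(\<nu> *\<^sub>R G) ** Z ** (\<nu> *\<^sub>R G) + (1/4) *\<^sub>R (Omega ** Z ** Omega) = G"
    unfolding Z_def using G by (rule sld_equation_solution) (use \<nu> in simp)
  have "sld_matrix cov 1 \<theta> = Z"
    unfolding sld_matrix_def cov deriv
  proof (rule the_equality)
    show "transpose Z = Z \<and>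
        (\<nu> *\<^sub>R G) ** Z ** (\<nu> *\<^sub>R G) + (1/4) *\<^sub>R (Omega ** Z ** Omega) = G"
      by (simp add: Z) (simp add: Z_def transpose_minus transpose_scalar matrix_transpose_mul transpose_Omega Gt
          matrix_minus_mult matrix_mul_assoc)
  next
    fix X
    assume "transpose X = X \<and>
        (\<nu> *\<^sub>R G) ** X ** (\<nu> *\<^sub>R G) + (1/4) *\<^sub>R (Omega ** X ** Omega) = G"
    \<comment> \<open>The equation is linear in the unknown, so two solutions differ by a solution
      of the homogeneous equation.\<close>
    then have "(\<nu> *\<^sub>R G) ** (X - Z) ** (\<nu> *\<^sub>R G) + (1/4) *\<^sub>R (Omega ** (X - Z) ** Omega) = 0"
      using Z by (simp add: matrix_diff_mult algebra_simps)
    then have "\<nu>\<^sup>2 *\<^sub>R (G ** (X - Z) ** G) = - (1/4) *\<^sub>R (Omega ** (X - Z) ** Omega)"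
      by (simp add: matrix_scalar_ac power2_eq_square eq_neg_iff_add_eq_0 flip: scalar_matrix_assoc)
    then have "(1 / \<nu>\<^sup>2) *\<^sub>R (\<nu>\<^sup>2 *\<^sub>R (G ** (X - Z) ** G))
        = (1 / \<nu>\<^sup>2) *\<^sub>R (- (1/4) *\<^sub>R (Omega ** (X - Z) ** Omega))"
      by (rule arg_cong)
    then have "G ** (X - Z) ** G = (- 1 / (4 * \<nu>\<^sup>2)) *\<^sub>R (Omega ** (X - Z) ** Omega)"
      using \<nu> by (simp add: split: if_splits)
    \<comment> \<open>For \<nu> > 1/2 this factor lies strictly between -1 and 0; at \<nu> = 1/2 it
      would be -1 and the kernel argument would fail.\<close>
    moreover have "(- 1 / (4 * \<nu>\<^sup>2))\<^sup>2 \<noteq> 1"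
      using \<nu> by (subst power2_eq_1_iff) (auto simp: divide_eq_eq)
    ultimately have "X - Z = 0"
      using G by (intro sld_equation_kernel)
    then show "X = Z"
      by simp
  qed
  then show ?thesis
    by (simp add: Z_def G_def \<nu>_def)
qed

lemma bures_metric_cov_1_1:
  fixes \<theta> :: "real^3"
  assumes "\<theta> $ 1 > 1/2"
  shows "bures_metric cov 1 1 \<theta> = 1 / (4 * (\<theta> $ 1)\<^sup>2 - 1)"
proof -
  define G where "G = squeeze (\<theta> $ 2) (\<theta> $ 3)"
  \<comment> \<open>The product is minus the inverse of \<open>G\<close> times \<open>G\<close>, so
    its trace is minus the dimension, whatever \<open>r\<close> and \<open>\<phi>\<close>
    are.\<close>
  have "Omega ** G ** Omega ** G = Omega ** (G ** Omega ** G)"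
    by (simp add: matrix_mul_assoc)
  then have "trace (Omega ** G ** Omega ** G) = - 2"
    by (simp add: G_def squeeze_Omega Omega_Omega) (simp add: trace_def mat_def sum_2)
  then have "fisher cov 1 1 \<theta> = 1 / ((\<theta> $ 1)\<^sup>2 - 1/4)"
    unfolding fisher_def sld_matrix_cov_1[OF assms] partial_deriv_cov_1
    by (simp add: G_def trace_minus trace_scaleR matrix_minus_mult flip: scalar_matrix_assoc)
  then show ?thesis
    by (simp add: bures_metric_def field_simps)
qed

lemma vector_derivative_radial_curve: "vector_derivative (radial_curve r \<phi>) (at t) = axis 1 1"
proof -
  have "radial_curve r \<phi> = (\<lambda>t. radial_curve r \<phi> 0 + t *\<^sub>R axis 1 1)"
    by (auto simp: radial_curve_def vec_eq_iff forall_3 axis_def)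
  moreover have "((\<lambda>t. radial_curve r \<phi> 0 + t *\<^sub>R axis 1 1) has_vector_derivative axis 1 1) (at t)"
    by (auto intro!: derivative_eq_intros simp: has_vector_derivative_def)
  ultimately show ?thesis
    by (metis vector_derivative_at)
qed

text \<open>The integrand blows up at 1/2. The fundamental theorem for nonnegative integrands asks
  only for one-sided limits of the antiderivative at the endpoints, and yields integrability along
  with the value.\<close>

lemma arcosh_double_integral:
  assumes "a > 1/2"
  shows "set_integrable lborel {1/2<..<a} (\<lambda>x. sqrt (1 / (4 * x\<^sup>2 - 1)))"
    and "(LINT x:{1/2<..<a}|lborel. sqrt (1 / (4 * x\<^sup>2 - 1))) = 1/2 * arcosh (2 * a)"
proof -
  let ?f = "\<lambda>x::real. sqrt (1 / (4 * x\<^sup>2 - 1))" and ?F = "\<lambda>x::real. 1/2 * arcosh (2 * x)"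
  have pos: "4 * x\<^sup>2 - 1 > 0" if "x > 1/2" for x :: real
    using power_strict_mono[of 1 "2 * x" 2] that by (simp add: power_mult_distrib)
  have F': "(?F has_real_derivative ?f x) (at x)" if "ereal (1/2) < ereal x" for x
    using that pos[of x]
    by (auto intro!: derivative_eq_intros DERIV_chain2[OF arcosh_real_has_field_derivative]
        simp: real_sqrt_divide power_mult_distrib)
  have f: "isCont ?f x" if "ereal (1/2) < ereal x" for x
    using that pos[of x] by (intro continuous_intros) auto
  have cont: "continuous_on {1/2..a} ?F"
    by (intro continuous_intros) auto
  \<comment> \<open>The limit is 0 because \<open>arcosh 1 = 0\<close>; \<open>arcosh\<close> is
    continuous at 1 although its slope is infinite there.\<close>
  have A: "((?F \<circ> real_of_ereal) \<longlongrightarrow> 0) (at_right (ereal (1/2)))"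
    using continuous_on_Icc_at_rightD[OF cont assms] by (simp add: ereal_tendsto_simps)
  have B: "((?F \<circ> real_of_ereal) \<longlongrightarrow> ?F a) (at_left (ereal a))"
    using continuous_on_Icc_at_leftD[OF cont assms] by (simp add: ereal_tendsto_simps)
  note FTC = interval_integral_FTC_nonneg[of "ereal (1/2)" "ereal a" ?F ?f, OF _ F' f _ A B]
  show "set_integrable lborel {1/2<..<a} ?f"
    using FTC(1) assms pos by (auto simp: less_imp_le)
  show "(LINT x:{1/2<..<a}|lborel. ?f x) = ?F a"
    using FTC(2) assms pos by (auto simp: less_imp_le interval_lebesgue_integral_def)
qed

text \<open>Integrability is asserted separately because the Lebesgue integral of a non-integrable
  function is 0 by convention.\<close>

theorem proposition4:
  fixes \<nu>0 r \<phi> :: real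
  assumes "\<nu>0 > 1/2"
  shows "bures_length cov (radial_curve r \<phi>) (1/2) \<nu>0 < \<infinity>
    \<and> set_integrable lborel {1/2<..<\<nu>0}
        (\<lambda>\<nu>. sqrt (bures_metric cov 1 1 (radial_curve r \<phi> \<nu>)))
    \<and> bures_length cov (radial_curve r \<phi>) (1/2) \<nu>0 =
        ennreal (LINT \<nu>:{1/2<..<\<nu>0}|lborel. sqrt (bures_metric cov 1 1 (radial_curve r \<phi> \<nu>)))
    \<and> (LINT \<nu>:{1/2<..<\<nu>0}|lborel. sqrt (bures_metric cov 1 1 (radial_curve r \<phi> \<nu>))) =
        1/2 * arcosh (2 * \<nu>0)"
proof -
  let ?I = "{1/2<..<\<nu>0}" and ?g = "\<lambda>\<nu>. sqrt (bures_metric cov 1 1 (radial_curve r \<phi> \<nu>))"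
  have g: "?g \<nu> = sqrt (1 / (4 * \<nu>\<^sup>2 - 1))" if "\<nu> \<in> ?I" for \<nu>
    using that by (simp add: bures_metric_cov_1_1 radial_curve_def)
  have integrable: "set_integrable lborel ?I ?g"
    using arcosh_double_integral(1)[OF assms] by (subst set_integrable_cong[OF refl refl g]) auto
  have integral: "(LINT \<nu>:?I|lborel. ?g \<nu>) = 1/2 * arcosh (2 * \<nu>0)"
    using arcosh_double_integral(2)[OF assms] g by (subst set_lebesgue_integral_cong[of _ _ ?g]) auto
  have nonneg: "?g \<nu> \<ge> 0" if "\<nu> \<in> ?I" for \<nu>
    using that power_strict_mono[of 1 "2 * \<nu>" 2] by (simp add: g power_mult_distrib)
  \<comment> \<open>The velocity is the first unit vector, so every other metric coefficient is
    multiplied by 0 and need not be computed.\<close>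
  have "(\<Sum>i\<in>UNIV. \<Sum>j\<in>UNIV. bures_metric cov i j \<theta> *
      vector_derivative (radial_curve r \<phi>) (at t) $ i *
      vector_derivative (radial_curve r \<phi>) (at t) $ j) = bures_metric cov 1 1 \<theta>" for \<theta> t
    by (simp add: vector_derivative_radial_curve sum_3 axis_def)
  then have "bures_length cov (radial_curve r \<phi>) (1/2) \<nu>0 = (\<integral>\<^sup>+\<nu>\<in>?I. ennreal (?g \<nu>) \<partial>lborel)"
    by (simp add: bures_length_def)
  \<comment> \<open>Moving the indicator inside \<open>ennreal\<close> gives the integrand of the
    set integral, whose nonnegativity identifies the two integrals.\<close>
  also have "\<dots> = (\<integral>\<^sup>+\<nu>. ennreal (indicator ?I \<nu> *\<^sub>R ?g \<nu>) \<partial>lborel)"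
    by (intro nn_integral_cong) (auto simp: indicator_def)
  also have "\<dots> = ennreal (LINT \<nu>:?I|lborel. ?g \<nu>)"
    unfolding set_lebesgue_integral_def using integrable nonneg
    by (intro nn_integral_eq_integral) (auto simp: set_integrable_def indicator_def)
  finally show ?thesis
    using integrable integral by (metis ennreal_less_top infinity_ennreal_def)
qed

end
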